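(* For each of the triplets $(e,e,e)$, $(e,e,12)$, $(e,e,23)$, $(e,e,123)$, $(e,e,132)$, $(e,13,123)$, $(e,23,123)$, $(e,123,123)$, $(e,132,123)$, the maximal entry $m_n$ of level $n$ of the associated TRIP-Stern tree is given for all $n\ge0$ by $m_n=\sum_{j=1}^3\alpha_j\beta_j^n$, where $\beta_1,\beta_2,\beta_3$ are the three roots of $x^3-x^2-1=0$ and $\alpha_1,\alpha_2,\alpha_3$ are the three roots of $31x^3-31x^2-12x-1=0$, each $\alpha_j$ being the coefficient attached to the root $\beta_j$. In particular $m_n=m_{n-1}+m_{n-3}$ for $n\ge3$.
   Context: Let $A_0=\begin{pmatrix}0&0&1\\1&0&0\\0&1&1\end{pmatrix}$, $A_1=\begin{pmatrix}1&0&1\\0&1&0\\0&0&1\end{pmatrix}$. Elements of $S_3$ are identified with permutation matrices: $e=I$, $(12)=\begin{pmatrix}0&1&0\\1&0&0\\0&0&1\end{pmatrix}$, $(13)=\begin{pmatrix}0&0&1\\0&1&0\\1&0&0\end{pmatrix}$, $(23)=\begin{pmatrix}1&0&0\\0&0&1\\0&1&0\end{pmatrix}$, $(123)=\begin{pmatrix}0&1&0\\0&0&1\\1&0&0\end{pmatrix}$, $(132)=\begin{pmatrix}0&0&1\\1&0&0\\0&1&0\end{pmatrix}$. For $(\sigma,\tau_0,\tau_1)\in S_3^3$ put $F_0=\sigma A_0\tau_0$, $F_1=\sigma A_1\tau_1$. For $v=(i_1,\dots,i_n)\in\{0,1\}^n$ let $\triangle(v)=(1,1,1)F_{i_1}\cdots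 F_{i_n}=(b_1(v),b_2(v),b_3(v))$. The maximal entry of level $n$ is $m_n=\max_{|v|=n}\max_i b_i(v)$, $n\ge0$. *)

theory Defs
  imports "HOL-Analysis.Analysis"
begin

definition A\<^sub>0 :: "int^3^3" where
  "A\<^sub>0 = vector [vector [0, 0, 1],
                vector [1, 0, 0],
                vector [0, 1, 1]]"

definition A\<^sub>1 :: "int^3^3" where
  "A\<^sub>1 = vector [vector [1, 0, 1],
                vector [0, 1, 0],
                vector [0, 0, 1]]"

text \<open>
  The elements of the symmetric group on three letters, identified with permutation matrices.
  The matrices themselves fix the convention, so no composition order for cycles is involved.
\<close>

definition p\<^sub>e :: "int^3^3" where
  "p\<^sub>e = mat 1"

definition p\<^sub>1\<^sub>2 :: "int^3^3" where
  "p\<^sub>1\<^sub>2 = vector [vector [0, 1, 0],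
                 vector [1, 0, 0],
                 vector [0, 0, 1]]"

definition p\<^sub>1\<^sub>3 :: "int^3^3" where
  "p\<^sub>1\<^sub>3 = vector [vector [0, 0, 1],
                 vector [0, 1, 0],
                 vector [1, 0, 0]]"

definition p\<^sub>2\<^sub>3 :: "int^3^3" where
  "p\<^sub>2\<^sub>3 = vector [vector [1, 0, 0],
                 vector [0, 0, 1],
                 vector [0, 1, 0]]"

definition p\<^sub>1\<^sub>2\<^sub>3 :: "int^3^3" where
  "p\<^sub>1\<^sub>2\<^sub>3 = vector [vector [0, 1, 0],
                  vector [0, 0, 1],
                  vector [1, 0, 0]]"

definition p\<^sub>1\<^sub>3\<^sub>2 :: "int^3^3" where
  "p\<^sub>1\<^sub>3\<^sub>2 = vector [vector [0, 0, 1],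
                  vector [1, 0, 0],
                  vector [0, 1, 0]]"

type_synonym triplet = "(int^3^3) \<times> (int^3^3) \<times> (int^3^3)"

text \<open>
  The argument \<open>i\<close> ranges over \<open>{0, 1}\<close>; the value at any other \<open>i\<close> is never used.
\<close>

fun F :: "triplet \<Rightarrow> nat \<Rightarrow> int^3^3" where
  "F (\<sigma>, \<tau>\<^sub>0, \<tau>\<^sub>1) i = (if i = 0 then \<sigma> ** A\<^sub>0 ** \<tau>\<^sub>0 else \<sigma> ** A\<^sub>1 ** \<tau>\<^sub>1)"

definition words :: "nat \<Rightarrow> nat list set" where
  "words n = {v. set v \<subseteq> {0, 1} \<and> length v = n}"

text \<open>
  The row vector \<open>(1, 1, 1)\<close> times \<open>F\<close> of the letters of \<open>v\<close>, the first letter acting first.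
\<close>

definition triangle :: "triplet \<Rightarrow> nat list \<Rightarrow> int^3" where
  "triangle t v = foldl (\<lambda>b i. b v* F t i) (vector [1, 1, 1]) v"

definition max_entry :: "triplet \<Rightarrow> nat \<Rightarrow> int" where
  "max_entry t n = (MAX v\<in>words n. MAX i\<in>UNIV. triangle t v $ i)"

end

theory Submission
  imports Defs "HOL-Computational_Algebra.Fundamental_Theorem_Algebra"
begin

text \<open>
  With \<open>N\<close> the Narayana sequence 1, 1, 1, 2, 3, 4, 6, ..., the maximal entry of level \<open>n\<close> is
  \<open>N (n + 2)\<close>. It is attained on a constant word, along which the entries are three consecutive
  terms of \<open>N\<close>. Up to order, a child of \<open>(x, y, z)\<close> is \<open>(y, z, x + z)\<close> or \<open>(x, y, x + z)\<close>; for two of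
  the triplets the entries stay below three consecutive terms of \<open>N\<close> in a fixed order, and for the
  others the bounds \<open>N (n + 2)\<close> on \<open>x, y, z\<close>, \<open>N (n + 3)\<close> on \<open>x + z\<close> and \<open>N (n + 4)\<close> on \<open>x + y + z\<close> are
  inherited by the children.

  The coefficient attached to a root \<open>b\<close> of \<open>x\<^sup>3 - x\<^sup>2 - 1\<close> is \<open>(4 + 6 b + 13 b\<^sup>2) / 31\<close>, by Vieta's
  formulas and \<open>N 2 = 1\<close>, \<open>N 3 = 2\<close>, \<open>N 4 = 3\<close>. As a map on the roots this has a polynomial inverse.
\<close>

section \<open>The Narayana sequence\<close>

text \<open>Indexed so that the row (1, 1, 1) at the root is the window N 0, N 1, N 2.\<close>

fun narayana :: "nat \<Rightarrow> int" where
  "narayana 0 = 1"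
| "narayana (Suc 0) = 1"
| "narayana (Suc (Suc 0)) = 1"
| "narayana (Suc (Suc (Suc n))) = narayana (Suc (Suc n)) + narayana n"

lemma narayana_pos: "narayana n > 0"
  by (induction n rule: narayana.induct) auto

lemma narayana_Suc_ge: "narayana n \<le> narayana (Suc n)"
  by (cases n rule: narayana.cases) (auto simp: less_imp_le narayana_pos)

section \<open>The action of the matrices on row vectors\<close>

lemma vector_matrix_mult_generators:
  fixes b :: "int^3"
  shows "b v* A\<^sub>0 = vector [b $ 2, b $ 3, b $ 1 + b $ 3]"
    and "b v* A\<^sub>1 = vector [b $ 1, b $ 2, b $ 1 + b $ 3]"
    and "b v* p\<^sub>e = b"
    and "b v* p\<^sub>1\<^sub>2 = vector [b $ 2, b $ 1, b $ 3]"
    and "b v* p\<^sub>1\<^sub>3 = vector [b $ 3, b $ 2, b $ 1]"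
    and "b v* p\<^sub>2\<^sub>3 = vector [b $ 1, b $ 3, b $ 2]"
    and "b v* p\<^sub>1\<^sub>2\<^sub>3 = vector [b $ 3, b $ 1, b $ 2]"
    and "b v* p\<^sub>1\<^sub>3\<^sub>2 = vector [b $ 2, b $ 3, b $ 1]"
  by (simp_all add: vec_eq_iff forall_3 vector_matrix_mult_def sum_3 mat_def A\<^sub>0_def A\<^sub>1_def
      p\<^sub>e_def p\<^sub>1\<^sub>2_def p\<^sub>1\<^sub>3_def p\<^sub>2\<^sub>3_def p\<^sub>1\<^sub>2\<^sub>3_def p\<^sub>1\<^sub>3\<^sub>2_def)

text \<open>Reversed associativity lets the factors of a product act on the row one at a time, from
  left to right.\<close>

lemmas child_simps = vector_matrix_mul_assoc [symmetric] vector_matrix_mult_generators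

section \<open>The maximal entry\<close>

lemma triangle_snoc: "triangle t (v @ [i]) = triangle t v v* F t i"
  by (simp add: triangle_def)

text \<open>The last letter acts last, so induction from the right end reduces a bound on a whole
  level to a check on the children of one row.\<close>

lemma triangle_invariant:
  assumes "I 0 (vector [1, 1, 1])"
    and "\<And>n b i. I n b \<Longrightarrow> i \<in> {0, 1} \<Longrightarrow> I (Suc n) (b v* F t i)"
    and "set v \<subseteq> {0, 1}"
  shows "I (length v) (triangle t v)"
  using assms(3)
proof (induction v rule: rev_induct)
  case Nil
  then show ?case using assms(1) by (simp add: triangle_def)
next
  case (snoc i v)
  then show ?case using assms(2) by (simp add: triangle_snoc)
qed

lemma finite_words: "finite (words n)"
  unfolding words_def by (rule finite_lists_length_eq) simp

lemma max_entry_eqI: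
  assumes bound: "\<And>v i. v \<in> words n \<Longrightarrow> triangle t v $ i \<le> m"
    and attained: "v \<in> words n" "triangle t v $ i = m"
  shows "max_entry t n = m"
  unfolding max_entry_def
proof (rule Max_eqI)
  show "finite ((\<lambda>v. MAX i. triangle t v $ i) ` words n)"
    by (simp add: finite_words)
  show "y \<le> m" if "y \<in> (\<lambda>v. MAX i. triangle t v $ i) ` words n" for y
    using that bound by auto
  have "(MAX i. triangle t v $ i) = m"
    using assms by (intro Max_eqI) auto
  then show "m \<in> (\<lambda>v. MAX i. triangle t v $ i) ` words n"
    using attained by force
qed

section \<open>Constant words attaining the maximum\<close>

lemma replicate_in_words: "i \<in> {0, 1} \<Longrightarrow> replicate n i \<in> words n"
  by (auto simp: words_def)

lemma replicate_snoc: "replicate (Suc n) x = replicate n x @ [x]"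
  by (simp add: replicate_append_same)

text \<open>The letter 0 sends (x, y, z) to (y, z, x + z), which moves the window one index forward
  by the recurrence of N.\<close>

lemma triangle_replicate_0:
  "triangle (p\<^sub>e, p\<^sub>e, \<tau>) (replicate n 0)
     = vector [narayana n, narayana (n + 1), narayana (n + 2)]"
proof (induction n)
  case 0
  then show ?case by (simp add: triangle_def)
next
  case (Suc n)
  then show ?case
    unfolding replicate_snoc triangle_snoc by (simp add: child_simps add.commute)
qed

text \<open>The letter 1 sends (x, y, z) to (x + z, x, y), the same shift in reversed order.\<close>

lemma triangle_replicate_1:
  "triangle (p\<^sub>e, \<tau>, p\<^sub>1\<^sub>2\<^sub>3) (replicate n 1)
     = vector [narayana (n + 2), narayana (n + 1), narayana n]"
proof (induction n)
  case 0
  then show ?case by (simp add: triangle_def)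
next
  case (Suc n)
  then show ?case
    unfolding replicate_snoc triangle_snoc by (simp add: child_simps add.commute)
qed

lemma max_entry_eq_narayana:
  assumes init: "I 0 (vector [1, 1, 1])"
    and step: "\<And>n b i. I n b \<Longrightarrow> i \<in> {0, 1} \<Longrightarrow> I (Suc n) (b v* F t i)"
    and bound: "\<And>n b i. I n b \<Longrightarrow> b $ i \<le> narayana (n + 2)"
    and t: "(\<exists>\<tau>. t = (p\<^sub>e, p\<^sub>e, \<tau>)) \<or> (\<exists>\<tau>. t = (p\<^sub>e, \<tau>, p\<^sub>1\<^sub>2\<^sub>3))"
  shows "max_entry t n = narayana (n + 2)"
proof -
  have le: "triangle t v $ i \<le> narayana (n + 2)" if "v \<in> words n" for v i
    using that bound triangle_invariant [of I t v, OF init step] by (auto simp: words_def)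
  have "\<exists>v\<in>words n. \<exists>i. triangle t v $ i = narayana (n + 2)"
    using t
  proof (elim disjE exE)
    fix \<tau> assume "t = (p\<^sub>e, p\<^sub>e, \<tau>)"
    then have "triangle t (replicate n 0) $ 3 = narayana (n + 2)"
      by (simp add: triangle_replicate_0)
    then show ?thesis using replicate_in_words by blast
  next
    fix \<tau> assume "t = (p\<^sub>e, \<tau>, p\<^sub>1\<^sub>2\<^sub>3)"
    then have "triangle t (replicate n 1) $ 1 = narayana (n + 2)"
      by (simp only: triangle_replicate_1 vector_3)
    then show ?thesis using replicate_in_words by blast
  qed
  then show ?thesis using max_entry_eqI le by blast
qed

section \<open>Bounds inherited by the children\<close>

definition increasing_bound :: "nat \<Rightarrow> int^3 \<Rightarrow> bool" where
  "increasing_bound n b \<longleftrightarrow>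
     b $ 1 \<le> narayana n \<and> b $ 2 \<le> narayana (n + 1) \<and> b $ 3 \<le> narayana (n + 2)"

definition decreasing_bound :: "nat \<Rightarrow> int^3 \<Rightarrow> bool" where
  "decreasing_bound n b \<longleftrightarrow>
     b $ 1 \<le> narayana (n + 2) \<and> b $ 2 \<le> narayana (n + 1) \<and> b $ 3 \<le> narayana n"

text \<open>The new entry of either child is x + z. The total of a child is x + y + z plus z or x,
  in step with N (n + 5) = N (n + 4) + N (n + 2). Nonnegativity bounds y + z and x + y by the
  total.\<close>

definition sum_bound :: "nat \<Rightarrow> int^3 \<Rightarrow> bool" where
  "sum_bound n b \<longleftrightarrow>
     (\<forall>i. 0 \<le> b $ i \<and> b $ i \<le> narayana (n + 2)) \<and>
     b $ 1 + b $ 3 \<le> narayana (n + 3) \<and> b $ 1 + b $ 2 + b $ 3 \<le> narayana (n + 4)"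

text \<open>The child (y, z, x + z) meets the shifted bounds directly, the child (x, y, x + z) by
  monotonicity of N.\<close>

lemma max_entry_increasing: "max_entry (p\<^sub>e, p\<^sub>e, p\<^sub>e) n = narayana (n + 2)"
proof (rule max_entry_eq_narayana [where I = increasing_bound])
  fix n b i
  assume b: "increasing_bound n b"
  show "increasing_bound (Suc n) (b v* F (p\<^sub>e, p\<^sub>e, p\<^sub>e) i)"
    using b narayana_Suc_ge [of n] narayana_Suc_ge [of "Suc n"]
    by (simp add: increasing_bound_def child_simps)
  show "b $ j \<le> narayana (n + 2)" for j
    using b narayana_Suc_ge [of n] narayana_Suc_ge [of "Suc n"] exhaust_3 [of j]
    by (auto simp: increasing_bound_def)
qed (auto simp: increasing_bound_def)

text \<open>The children are (x + z, y, z) and (x + z, x, y); the first uses monotonicity of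
  N.\<close>

lemma max_entry_decreasing: "max_entry (p\<^sub>e, p\<^sub>1\<^sub>2\<^sub>3, p\<^sub>1\<^sub>2\<^sub>3) n = narayana (n + 2)"
proof (rule max_entry_eq_narayana [where I = decreasing_bound])
  fix n b i
  assume b: "decreasing_bound n b"
  show "decreasing_bound (Suc n) (b v* F (p\<^sub>e, p\<^sub>1\<^sub>2\<^sub>3, p\<^sub>1\<^sub>2\<^sub>3) i)"
    using b narayana_Suc_ge [of n] narayana_Suc_ge [of "Suc n"]
    by (simp add: decreasing_bound_def child_simps)
  show "b $ j \<le> narayana (n + 2)" for j
    using b narayana_Suc_ge [of n] narayana_Suc_ge [of "Suc n"] exhaust_3 [of j]
    by (auto simp: decreasing_bound_def)
qed (auto simp: decreasing_bound_def)

text \<open>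
  The excluded permutations are those placing the new entry \<open>x + z\<close> and the surviving one of
  \<open>x, z\<close> in positions 1 and 3, where their sum need not be bounded by \<open>x + y + z\<close>.
\<close>

lemma sum_bound_child_0:
  assumes "sum_bound n b" "\<tau> \<in> {p\<^sub>e, p\<^sub>1\<^sub>3, p\<^sub>2\<^sub>3, p\<^sub>1\<^sub>3\<^sub>2}"
  shows "sum_bound (Suc n) (b v* (p\<^sub>e ** A\<^sub>0 ** \<tau>))"
  using assms narayana_Suc_ge [of "Suc (Suc n)"]
  by (auto simp: sum_bound_def child_simps forall_3 eval_nat_numeral)

lemma sum_bound_child_1:
  assumes "sum_bound n b" "\<tau> \<in> {p\<^sub>1\<^sub>2, p\<^sub>2\<^sub>3, p\<^sub>1\<^sub>2\<^sub>3, p\<^sub>1\<^sub>3\<^sub>2}"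
  shows "sum_bound (Suc n) (b v* (p\<^sub>e ** A\<^sub>1 ** \<tau>))"
  using assms narayana_Suc_ge [of "Suc (Suc n)"]
  by (auto simp: sum_bound_def child_simps forall_3 eval_nat_numeral)

text \<open>Serves seven of the nine triplets. The last assumption provides the constant word that
  attains the bound.\<close>

lemma max_entry_sum_bound:
  assumes "\<tau>\<^sub>0 \<in> {p\<^sub>e, p\<^sub>1\<^sub>3, p\<^sub>2\<^sub>3, p\<^sub>1\<^sub>3\<^sub>2}" "\<tau>\<^sub>1 \<in> {p\<^sub>1\<^sub>2, p\<^sub>2\<^sub>3, p\<^sub>1\<^sub>2\<^sub>3, p\<^sub>1\<^sub>3\<^sub>2}"
    and "\<tau>\<^sub>0 = p\<^sub>e \<or> \<tau>\<^sub>1 = p\<^sub>1\<^sub>2\<^sub>3"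
  shows "max_entry (p\<^sub>e, \<tau>\<^sub>0, \<tau>\<^sub>1) n = narayana (n + 2)"
proof (rule max_entry_eq_narayana [where I = sum_bound])
  show "sum_bound 0 (vector [1, 1, 1])"
    by (simp add: sum_bound_def forall_3 eval_nat_numeral)
  show "(\<exists>\<tau>. (p\<^sub>e, \<tau>\<^sub>0, \<tau>\<^sub>1) = (p\<^sub>e, p\<^sub>e, \<tau>)) \<or> (\<exists>\<tau>. (p\<^sub>e, \<tau>\<^sub>0, \<tau>\<^sub>1) = (p\<^sub>e, \<tau>, p\<^sub>1\<^sub>2\<^sub>3))"
    using assms(3) by auto
next
  fix n b i
  assume b: "sum_bound n b"
  show "sum_bound (Suc n) (b v* F (p\<^sub>e, \<tau>\<^sub>0, \<tau>\<^sub>1) i)"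
    using sum_bound_child_0 [OF b assms(1)] sum_bound_child_1 [OF b assms(2)] by simp
  show "b $ j \<le> narayana (n + 2)" for j
    using b by (simp add: sum_bound_def)
qed

section \<open>The two cubics\<close>

text \<open>With the power sums 3, 1, 1, 4, 5 of the roots, u + v b + w b^2 is found from 3u + v + w
  = 1, u + v + 4w = 2, u + 4v + 5w = 3. The discriminant of the cubic is -31.\<close>

definition coefficient :: "complex \<Rightarrow> complex" where
  "coefficient b = (4 + 6 * b + 13 * b ^ 2) / 31"

text \<open>Expresses b through 1, a, a^2 after reduction by b^3 = b^2 + 1; it inverts
  \<open>coefficient\<close> only on the roots.\<close>

definition coefficient_inv :: "complex \<Rightarrow> complex" where
  "coefficient_inv a = 403 * a ^ 2 - 465 * a - 83"

lemma bij_betw_coefficient: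
  "bij_betw coefficient {x. x ^ 3 - x ^ 2 - 1 = 0} {x. 31 * x ^ 3 - 31 * x ^ 2 - 12 * x - 1 = 0}"
proof (rule bij_betw_byWitness [where f' = coefficient_inv])
  show "\<forall>b\<in>{x. x ^ 3 - x ^ 2 - 1 = 0}. coefficient_inv (coefficient b) = b"
  proof
    fix b :: complex assume "b \<in> {x. x ^ 3 - x ^ 2 - 1 = 0}"
    then have "b ^ 3 - b ^ 2 - 1 = 0" by simp
    moreover have "31 * coefficient b = 4 + 6 * b + 13 * b ^ 2"
      by (simp add: coefficient_def)
    \<comment> \<open>The factor clears the denominators of a quadratic in
      \<open>coefficient b\<close>.\<close>
    ultimately have "31 ^ 2 * coefficient_inv (coefficient b) = 31 ^ 2 * b"
      unfolding coefficient_inv_def by algebra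
    then show "coefficient_inv (coefficient b) = b" by simp
  qed
  show "\<forall>a\<in>{x. 31 * x ^ 3 - 31 * x ^ 2 - 12 * x - 1 = 0}. coefficient (coefficient_inv a) = a"
  proof
    fix a :: complex assume "a \<in> {x. 31 * x ^ 3 - 31 * x ^ 2 - 12 * x - 1 = 0}"
    then have "31 * a ^ 3 - 31 * a ^ 2 - 12 * a - 1 = 0" by simp
    moreover have "31 * coefficient (coefficient_inv a)
        = 4 + 6 * coefficient_inv a + 13 * coefficient_inv a ^ 2"
      by (simp add: coefficient_def)
    ultimately have "31 * coefficient (coefficient_inv a) = 31 * a"
      unfolding coefficient_inv_def by algebra
    then show "coefficient (coefficient_inv a) = a" by simp
  qed
  show "coefficient ` {x. x ^ 3 - x ^ 2 - 1 = 0} \<subseteq> {x. 31 * x ^ 3 - 31 * x ^ 2 - 12 * x - 1 = 0}"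
  proof clarify
    fix b :: complex assume "b ^ 3 - b ^ 2 - 1 = 0"
    moreover have "31 * coefficient b = 4 + 6 * b + 13 * b ^ 2"
      by (simp add: coefficient_def)
    ultimately have "31 ^ 2 * (31 * coefficient b ^ 3 - 31 * coefficient b ^ 2
        - 12 * coefficient b - 1) = 0"
      by algebra
    then show "31 * coefficient b ^ 3 - 31 * coefficient b ^ 2 - 12 * coefficient b - 1 = 0"
      by (simp only: mult_eq_0_iff) simp
  qed
  show "coefficient_inv ` {x. 31 * x ^ 3 - 31 * x ^ 2 - 12 * x - 1 = 0} \<subseteq> {x. x ^ 3 - x ^ 2 - 1 = 0}"
  proof clarify
    fix a :: complex assume "31 * a ^ 3 - 31 * a ^ 2 - 12 * a - 1 = 0"
    then show "coefficient_inv a ^ 3 - coefficient_inv a ^ 2 - 1 = 0"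
      unfolding coefficient_inv_def by algebra
  qed
qed

section \<open>Simple roots and the closed form\<close>

lemma card_roots_rsquarefree:
  fixes p :: "complex poly"
  assumes "rsquarefree p"
  shows "card {z. poly p z = 0} = degree p"
proof -
  have "p \<noteq> 0" using assms by (simp add: rsquarefree_def)
  have "degree p = degree (smult (lead_coeff p) (\<Prod>z|poly p z = 0. [:-z, 1:]))"
    using complex_poly_decompose_rsquarefree [OF assms] by simp
  also have "\<dots> = degree (\<Prod>z|poly p z = 0. [:-z, 1:])"
    using \<open>p \<noteq> 0\<close> by simp
  also have "\<dots> = card {z. poly p z = 0}"
    by (subst degree_prod_eq_sum_degree) auto
  finally show ?thesis ..
qed

lemma card_roots_cubic: "card {x :: complex. x ^ 3 - x ^ 2 - 1 = 0} = 3"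
proof -
  define p :: "complex poly" where "p = [:-1, 0, -1, 1:]"
  have poly_p: "poly p x = x ^ 3 - x ^ 2 - 1" for x
    by (simp add: p_def algebra_simps power2_eq_square power3_eq_cube)
  have False if "poly p x = 0" "poly (pderiv p) x = 0" for x
  proof -
    have "x ^ 3 - x ^ 2 - 1 = 0" using that(1) by (simp add: poly_p)
    moreover have "3 * x ^ 2 - 2 * x = 0"
      using that(2) by (simp add: p_def pderiv_pCons algebra_simps power2_eq_square)
    \<comment> \<open>The resultant of the cubic and its derivative is 31, so it lies in the ideal
      they generate.\<close>
    ultimately have "(31 :: complex) = 0" by algebra
    then show False by simp
  qed
  then have "rsquarefree p" by (auto simp: rsquarefree_roots)
  from card_roots_rsquarefree [OF this] show ?thesis
    by (simp add: poly_p) (simp add: p_def)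
qed

lemma narayana_closed_form:
  fixes a b c :: complex
  assumes roots: "a ^ 3 - a ^ 2 - 1 = 0" "b ^ 3 - b ^ 2 - 1 = 0" "c ^ 3 - c ^ 2 - 1 = 0"
    and distinct: "a \<noteq> b" "a \<noteq> c" "b \<noteq> c"
  shows "of_int (narayana (n + 2))
    = coefficient a * a ^ n + coefficient b * b ^ n + coefficient c * c ^ n"
proof -
  \<comment> \<open>Vieta's formulas come from first and second divided differences of the cubic at
    its distinct roots.\<close>
  have "(a - b) * (a ^ 2 + a * b + b ^ 2 - a - b) = 0" using roots by algebra
  then have ab: "a ^ 2 + a * b + b ^ 2 - a - b = 0" using distinct by simp
  have "(a - c) * (a ^ 2 + a * c + c ^ 2 - a - c) = 0" using roots by algebra
  then have ac: "a ^ 2 + a * c + c ^ 2 - a - c = 0" using distinct by simp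
  have "(b - c) * (a + b + c - 1) = 0" using ab ac by algebra
  then have e1: "a + b + c = 1" using distinct by simp
  have e2: "a * b + a * c + b * c = 0" using e1 ab by algebra
  have coeff: "31 * coefficient x = 4 + 6 * x + 13 * x ^ 2" for x
    by (simp add: coefficient_def)
  define s where "s = (\<lambda>n. coefficient a * a ^ n + coefficient b * b ^ n + coefficient c * c ^ n)"
  have "31 * s 0 = 31 * 1"
    unfolding s_def using coeff [of a] coeff [of b] coeff [of c] e1 e2 roots by algebra
  then have s0: "s 0 = 1" by simp
  have "31 * s 1 = 31 * 2"
    unfolding s_def using coeff [of a] coeff [of b] coeff [of c] e1 e2 roots by algebra
  then have s1: "s 1 = 2" by simp
  have "31 * s 2 = 31 * 3"
    unfolding s_def using coeff [of a] coeff [of b] coeff [of c] e1 e2 roots by algebra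
  then have s2: "s 2 = 3" by simp
  have rec: "s (n + 3) = s (n + 2) + s n" for n
  proof -
    have "x ^ (n + 3) = x ^ (n + 2) + x ^ n" if "x ^ 3 - x ^ 2 - 1 = 0" for x :: complex
    proof -
      have "x ^ 3 = x ^ 2 + 1" using that by algebra
      then show ?thesis by (simp only: power_add distrib_left mult_1_right)
    qed
    then show ?thesis using roots by (simp add: s_def algebra_simps)
  qed
  have "of_int (narayana (n + 2)) = s n"
  proof (induction n rule: narayana.induct)
    case (4 n)
    have "narayana (Suc (Suc (Suc n)) + 2) = narayana (Suc (Suc n) + 2) + narayana (n + 2)"
      by simp
    moreover have "s (Suc (Suc (Suc n))) = s (Suc (Suc n)) + s n"
      using rec [of n] by (simp add: eval_nat_numeral)
    ultimately show ?case using 4 by (simp only: of_int_add)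
  qed (use s0 s1 s2 in \<open>simp_all add: eval_nat_numeral\<close>)
  then show ?thesis by (simp add: s_def)
qed

theorem theorem13:
  shows "\<exists>\<alpha> \<beta> :: nat \<Rightarrow> complex.
    bij_betw \<beta> {1..3} {x. x ^ 3 - x ^ 2 - 1 = 0} \<and>
    bij_betw \<alpha> {1..3} {x. 31 * x ^ 3 - 31 * x ^ 2 - 12 * x - 1 = 0} \<and>
    (\<forall>t \<in> {(p\<^sub>e, p\<^sub>e, p\<^sub>e), (p\<^sub>e, p\<^sub>e, p\<^sub>1\<^sub>2), (p\<^sub>e, p\<^sub>e, p\<^sub>2\<^sub>3),
            (p\<^sub>e, p\<^sub>e, p\<^sub>1\<^sub>2\<^sub>3), (p\<^sub>e, p\<^sub>e, p\<^sub>1\<^sub>3\<^sub>2), (p\<^sub>e, p\<^sub>1\<^sub>3, p\<^sub>1\<^sub>2\<^sub>3),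
            (p\<^sub>e, p\<^sub>2\<^sub>3, p\<^sub>1\<^sub>2\<^sub>3), (p\<^sub>e, p\<^sub>1\<^sub>2\<^sub>3, p\<^sub>1\<^sub>2\<^sub>3), (p\<^sub>e, p\<^sub>1\<^sub>3\<^sub>2, p\<^sub>1\<^sub>2\<^sub>3)}.
      (\<forall>n. of_int (max_entry t n) = (\<Sum>j=1..3. \<alpha> j * \<beta> j ^ n)) \<and>
      (\<forall>n\<ge>3. max_entry t n = max_entry t (n - 1) + max_entry t (n - 3)))"
proof -
  have "finite {x :: complex. x ^ 3 - x ^ 2 - 1 = 0}"
    \<comment> \<open>An infinite set would have \<open>card\<close> 0.\<close>
    by (rule card_ge_0_finite) (simp only: card_roots_cubic zero_less_numeral)
  from ex_bij_betw_nat_finite_1 [OF this]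
  obtain \<beta> :: "nat \<Rightarrow> complex" where \<beta>: "bij_betw \<beta> {1..3} {x. x ^ 3 - x ^ 2 - 1 = 0}"
    unfolding card_roots_cubic ..
  \<comment> \<open>Composition attaches each coefficient to its own root.\<close>
  have bij: "bij_betw (coefficient \<circ> \<beta>) {1..3} {x. 31 * x ^ 3 - 31 * x ^ 2 - 12 * x - 1 = 0}"
    using \<beta> bij_betw_coefficient by (rule bij_betw_trans)
  have root: "\<beta> j ^ 3 - \<beta> j ^ 2 - 1 = 0" if "j \<in> {1..3}" for j
    using bij_betwE [OF \<beta>] that by blast
  have "inj_on \<beta> {1..3}" using \<beta> by (rule bij_betw_imp_inj_on)
  then have distinct: "\<beta> 1 \<noteq> \<beta> 2" "\<beta> 1 \<noteq> \<beta> 3" "\<beta> 2 \<noteq> \<beta> 3"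
    by (simp_all add: inj_on_eq_iff)
  have closed_form: "of_int (narayana (n + 2)) = (\<Sum>j=1..3. (coefficient \<circ> \<beta>) j * \<beta> j ^ n)" for n
  proof -
    have "{1..3} = {1, 2, 3 :: nat}" by auto
    then show ?thesis
      using narayana_closed_form [OF root root root distinct, of n] by (simp add: add.assoc)
  qed
  have rec: "narayana (n + 2) = narayana (n - 1 + 2) + narayana (n - 3 + 2)" if "n \<ge> 3" for n
    using that by (cases n rule: narayana.cases) simp_all
  show ?thesis
  proof (intro exI conjI ballI)
    show "bij_betw \<beta> {1..3} {x. x ^ 3 - x ^ 2 - 1 = 0}" by (fact \<beta>)
    show "bij_betw (coefficient \<circ> \<beta>) {1..3} {x. 31 * x ^ 3 - 31 * x ^ 2 - 12 * x - 1 = 0}"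
      by (fact bij)
  next
    fix t
    assume "t \<in> {(p\<^sub>e, p\<^sub>e, p\<^sub>e), (p\<^sub>e, p\<^sub>e, p\<^sub>1\<^sub>2), (p\<^sub>e, p\<^sub>e, p\<^sub>2\<^sub>3),
            (p\<^sub>e, p\<^sub>e, p\<^sub>1\<^sub>2\<^sub>3), (p\<^sub>e, p\<^sub>e, p\<^sub>1\<^sub>3\<^sub>2), (p\<^sub>e, p\<^sub>1\<^sub>3, p\<^sub>1\<^sub>2\<^sub>3),
            (p\<^sub>e, p\<^sub>2\<^sub>3, p\<^sub>1\<^sub>2\<^sub>3), (p\<^sub>e, p\<^sub>1\<^sub>2\<^sub>3, p\<^sub>1\<^sub>2\<^sub>3), (p\<^sub>e, p\<^sub>1\<^sub>3\<^sub>2, p\<^sub>1\<^sub>2\<^sub>3)}"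
    then have m: "max_entry t n = narayana (n + 2)" for n
      by (elim insertE emptyE) (simp_all only: max_entry_increasing max_entry_decreasing
          max_entry_sum_bound insert_iff simp_thms)
    show "\<forall>n. of_int (max_entry t n) = (\<Sum>j=1..3. (coefficient \<circ> \<beta>) j * \<beta> j ^ n)"
      unfolding m using closed_form by blast
    show "\<forall>n\<ge>3. max_entry t n = max_entry t (n - 1) + max_entry t (n - 3)"
      unfolding m using rec by blast
  qed
qed

end
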